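(* Let $Q=(q_{ij})$ be a real symmetric $n\times n$ matrix with zero diagonal, $c\in\mathbb{R}^n$, $R_i=\{j:q_{ij}\neq0\}$, and let $\gamma_{ij}>0$ for $j\in R_i$, $i=1,\dots,n$. Consider the MILP FT($*,\gamma$) in variables $x_i$ and $y_{ij}$ ($j\in R_i$): maximize $\sum_{i=1}^n\sum_{j\in R_i}q_{ij}y_{ij}+\sum_{i=1}^n c_ix_i$ subject to $x_i+x_j-y_{ij}\le 1$ for all $j\in R_i$, $i=1,\dots,n$; $\sum_{j\in R_i}\gamma_{ij}y_{ij}\le\left(\sum_{j\in R_i}\gamma_{ij}\right)x_i$ for $i=1,\dots,n$; $y_{ij}-y_{ji}\le 0$ for all $j\in R_i$, $i=1,\dots,n$; $x_i\in\{0,1\}$ for all $i$; $0\le y_{ij}\le 1$ for all $j\in R_i$, $i=1,\dots,n$. Then FT($*,\gamma$) is a valid formulation of QUBO.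
   Context: QUBO is the problem: maximize $\sum_{i=1}^n\sum_{j\in R_i}q_{ij}x_ix_j+\sum_{i=1}^n c_ix_i$ over $x\in\{0,1\}^n$. An MILP in variables $(x,y)$ with objective $\sum_i\sum_{j\in R_i}q_{ij}y_{ij}+\sum_i c_ix_i$ is a valid formulation of QUBO if its optimal objective value equals the optimal value of QUBO and the $x$-part of every optimal solution of the MILP is an optimal solution of QUBO. *)

theory Defs
  imports "HOL-Analysis.Analysis"
begin

definition optimal_solution :: "'s set \<Rightarrow> ('s \<Rightarrow> real) \<Rightarrow> 's \<Rightarrow> bool" where
  "optimal_solution F f s \<longleftrightarrow> s \<in> F \<and> (\<forall>t\<in>F. f t \<le> f s)"

(* A maximization problem has an optimal value only if the maximum is attained,
   so this is a relation and not a supremum. *)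
definition optimal_value :: "'s set \<Rightarrow> ('s \<Rightarrow> real) \<Rightarrow> real \<Rightarrow> bool" where
  "optimal_value F f v \<longleftrightarrow> (\<exists>s. optimal_solution F f s \<and> f s = v)"

definition R :: "real^'n^'n \<Rightarrow> 'n \<Rightarrow> 'n set" where
  "R Q i = {j. Q $ i $ j \<noteq> 0}"

definition binary_vectors :: "(real^'n) set" where
  "binary_vectors = {x. \<forall>i. x $ i \<in> {0, 1}}"

definition qubo_objective :: "real^'n^'n \<Rightarrow> real^'n \<Rightarrow> real^'n \<Rightarrow> real" where
  "qubo_objective Q c x =
     (\<Sum>i\<in>UNIV. \<Sum>j\<in>R Q i. Q $ i $ j * x $ i * x $ j) + (\<Sum>i\<in>UNIV. c $ i * x $ i)"

(* The variables y(i,j) exist only for j in R Q i; this is the space of such real families,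
   with the library's convention of the value undefined outside the index set. *)
definition y_space :: "real^'n^'n \<Rightarrow> ('n \<times> 'n \<Rightarrow> real) set" where
  "y_space Q = extensional (SIGMA i:UNIV. R Q i)"

definition milp_objective ::
    "real^'n^'n \<Rightarrow> real^'n \<Rightarrow> (real^'n) \<times> ('n \<times> 'n \<Rightarrow> real) \<Rightarrow> real" where
  "milp_objective Q c = (\<lambda>(x, y).
     (\<Sum>i\<in>UNIV. \<Sum>j\<in>R Q i. Q $ i $ j * y (i, j)) + (\<Sum>i\<in>UNIV. c $ i * x $ i))"

(* F is the feasible set of the MILP; its objective is milp_objective. *)
definition valid_formulation ::
    "real^'n^'n \<Rightarrow> real^'n \<Rightarrow> ((real^'n) \<times> ('n \<times> 'n \<Rightarrow> real)) set \<Rightarrow> bool" where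
  "valid_formulation Q c F \<longleftrightarrow>
     (\<exists>v. optimal_value F (milp_objective Q c) v \<and>
          optimal_value binary_vectors (qubo_objective Q c) v) \<and>
     (\<forall>x y. optimal_solution F (milp_objective Q c) (x, y) \<longrightarrow>
            optimal_solution binary_vectors (qubo_objective Q c) x)"

definition FT_feasible ::
    "real^'n^'n \<Rightarrow> ('n \<Rightarrow> 'n \<Rightarrow> real) \<Rightarrow> ((real^'n) \<times> ('n \<times> 'n \<Rightarrow> real)) set" where
  "FT_feasible Q \<gamma> = {(x, y). y \<in> y_space Q \<and>
     (\<forall>i. \<forall>j\<in>R Q i. x $ i + x $ j - y (i, j) \<le> 1) \<and>
     (\<forall>i. (\<Sum>j\<in>R Q i. \<gamma> i j * y (i, j)) \<le> (\<Sum>j\<in>R Q i. \<gamma> i j) * x $ i) \<and>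
     (\<forall>i. \<forall>j\<in>R Q i. y (i, j) - y (j, i) \<le> 0) \<and>
     (\<forall>i. x $ i \<in> {0, 1}) \<and>
     (\<forall>i. \<forall>j\<in>R Q i. 0 \<le> y (i, j) \<and> y (i, j) \<le> 1)}"

end

(* The constraints on y leave no freedom: y(i,j) = y(j,i), the knapsack constraint of i forces
   y(i,j) = 0 when x(i) = 0, and y(i,j) = 1 when x(i) = x(j) = 1.  Hence the feasible set is the
   graph of the map sending a binary x to the products x(i) x(j), and along this graph the two
   objectives agree. *)
theory Submission
  imports Defs
begin

text \<open>\<open>restrict\<close> puts the family into \<open>y_space Q\<close>, so the y-part of
  a feasible point can equal it as a function and not only on the index pairs.\<close>

definition product_family :: "real^'n^'n \<Rightarrow> real^'n \<Rightarrow> 'n \<times> 'n \<Rightarrow> real" where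
  "product_family Q x = restrict (\<lambda>(i, j). x $ i * x $ j) (SIGMA i:UNIV. R Q i)"

lemma product_family_apply: "j \<in> R Q i \<Longrightarrow> product_family Q x (i, j) = x $ i * x $ j"
  by (simp add: product_family_def)

lemma milp_objective_product_family:
  "milp_objective Q c (x, product_family Q x) = qubo_objective Q c x"
  by (simp add: milp_objective_def qubo_objective_def product_family_apply mult.assoc)

text \<open>Finiteness guarantees that the QUBO maximum is attained, as \<open>optimal_value\<close>
  demands.\<close>

lemma finite_binary_vectors: "finite (binary_vectors :: (real^'n) set)"
proof -
  have "vec_nth ` (binary_vectors :: (real^'n) set) \<subseteq> UNIV \<rightarrow>\<^sub>E {0, 1}"
    by (auto simp: binary_vectors_def)
  moreover have "finite (UNIV \<rightarrow>\<^sub>E {0, 1} :: ('n \<Rightarrow> real) set)"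
    by (rule finite_PiE) auto
  moreover have "inj_on vec_nth (binary_vectors :: (real^'n) set)"
    by (auto simp: inj_on_def vec_eq_iff)
  ultimately show ?thesis
    by (meson finite_imageD finite_subset)
qed

lemma optimal_solution_exists:
  assumes "finite F" "F \<noteq> {}"
  shows "\<exists>s. optimal_solution F f s"
proof -
  have "Max (f ` F) \<in> f ` F"
    using assms by simp
  then obtain s where "s \<in> F" "f s = Max (f ` F)"
    by auto
  then show ?thesis
    using assms by (auto simp: optimal_solution_def)
qed

text \<open>Forgetting y is a bijection from a graph over the binary vectors onto these vectors. As
  it preserves the objective, it matches optimal solutions with optimal solutions and keeps the
  optimal value.\<close>

lemma valid_formulation_graph:
  assumes F: "F = (\<lambda>x. (x, g x)) ` binary_vectors"
    and obj: "\<And>x. x \<in> binary_vectors \<Longrightarrow> milp_objective Q c (x, g x) = qubo_objective Q c x"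
  shows "valid_formulation Q c F"
proof -
  have opt: "optimal_solution F (milp_objective Q c) (x, y) \<longleftrightarrow>
      y = g x \<and> optimal_solution binary_vectors (qubo_objective Q c) x" for x y
    by (auto simp: optimal_solution_def F obj)
  have "0 \<in> binary_vectors"
    by (simp add: binary_vectors_def)
  then obtain x where x: "optimal_solution binary_vectors (qubo_objective Q c) x"
    using optimal_solution_exists[OF finite_binary_vectors] by blast
  then have "x \<in> binary_vectors"
    by (simp add: optimal_solution_def)
  then have "\<exists>v. optimal_value F (milp_objective Q c) v \<and>
      optimal_value binary_vectors (qubo_objective Q c) v"
    using x opt[of x "g x"] obj[of x] unfolding optimal_value_def by blast
  then show ?thesis
    by (simp add: valid_formulation_def opt)
qed

lemma FT_feasible_eq:
  assumes sym: "transpose Q = Q"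
    and pos: "\<forall>i. \<forall>j\<in>R Q i. \<gamma> i j > 0"
  shows "FT_feasible Q \<gamma> = (\<lambda>x. (x, product_family Q x)) ` binary_vectors"
proof -
  \<comment> \<open>By symmetry of \<open>Q\<close>, \<open>y (j, i)\<close> is a genuine variable
    whenever \<open>y (i, j)\<close> is, and it occurs in the knapsack constraint of
    \<open>j\<close>.\<close>
  have R_sym: "i \<in> R Q j" if "j \<in> R Q i" for i j
    using that sym by (metis (mono_tags, lifting) R_def mem_Collect_eq transpose_def vec_lambda_beta)
  have "y = product_family Q x" if xy: "(x, y) \<in> FT_feasible Q \<gamma>" for x y
  proof (rule extensionalityI)
    show "y \<in> extensional (SIGMA i:UNIV. R Q i)"
      using xy by (simp add: FT_feasible_def y_space_def)
    show "product_family Q x \<in> extensional (SIGMA i:UNIV. R Q i)"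
      by (simp add: product_family_def)
    \<comment> \<open>For \<open>x $ i = 0\<close> the right side of the knapsack constraint
      vanishes. Its left side is a sum of nonnegative terms, so each term is 0, and the positive
      weight cancels.\<close>
    have zero: "y (i, j) = 0" if "x $ i = 0" "j \<in> R Q i" for i j
    proof -
      have nonneg: "0 \<le> \<gamma> i k * y (i, k)" if "k \<in> R Q i" for k
        using xy pos that by (simp add: FT_feasible_def less_imp_le)
      have "(\<Sum>k\<in>R Q i. \<gamma> i k * y (i, k)) \<le> (\<Sum>k\<in>R Q i. \<gamma> i k) * x $ i"
        using xy by (simp add: FT_feasible_def)
      then have "(\<Sum>k\<in>R Q i. \<gamma> i k * y (i, k)) = 0"
        using \<open>x $ i = 0\<close> sum_nonneg[OF nonneg] by force
      then have "\<gamma> i j * y (i, j) = 0"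
        using nonneg \<open>j \<in> R Q i\<close> by (simp add: sum_nonneg_eq_0_iff)
      then show ?thesis
        using pos \<open>j \<in> R Q i\<close> by force
    qed
    fix p assume "p \<in> (SIGMA i:UNIV. R Q i)"
    then obtain i j where p: "p = (i, j)" and j: "j \<in> R Q i"
      by auto
    have y: "x $ i + x $ j - y (i, j) \<le> 1" "y (i, j) \<le> y (j, i)" "0 \<le> y (i, j)" "y (i, j) \<le> 1"
      and x: "x $ i \<in> {0, 1}" "x $ j \<in> {0, 1}"
      using xy j by (auto simp: FT_feasible_def)
    consider "x $ i = 0" | "x $ j = 0" | "x $ i = 1" "x $ j = 1"
      using x by auto
    then have "y (i, j) = x $ i * x $ j"
    proof cases
      case 1
      then show ?thesis using zero[OF _ j] by simp
    next
      case 2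
      \<comment> \<open>The knapsack constraint of \<open>j\<close> gives
        \<open>y (j, i) = 0\<close>, which \<open>y (i, j) \<le> y (j, i)\<close> passes on to
        \<open>y (i, j)\<close>.\<close>
      then show ?thesis using zero[OF _ R_sym[OF j]] y by simp
    next
      case 3
      \<comment> \<open>The first constraint now reads \<open>2 - y (i, j) \<le> 1\<close>, which
        meets the upper bound 1.\<close>
      then show ?thesis using y by simp
    qed
    then show "y p = product_family Q x p"
      by (simp add: p j product_family_apply)
  qed
  moreover have "x \<in> binary_vectors" if "(x, y) \<in> FT_feasible Q \<gamma>" for x y
    using that by (simp add: FT_feasible_def binary_vectors_def)
  moreover have "(x, product_family Q x) \<in> FT_feasible Q \<gamma>" if "x \<in> binary_vectors" for x
  proof -
    have x: "x $ i = 0 \<or> x $ i = 1" for i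
      using that by (auto simp: binary_vectors_def)
    then have bounds: "0 \<le> x $ i" "x $ i \<le> 1" for i
      by (metis order_refl zero_le_one)+
    have "x $ i + x $ j - x $ i * x $ j \<le> 1" for i j
      using x[of i] x[of j] by auto
    \<comment> \<open>The bound holds term by term, since \<open>x $ j \<le> 1\<close> gives
      \<open>x $ i * x $ j \<le> x $ i\<close>.\<close>
    moreover have "(\<Sum>j\<in>R Q i. \<gamma> i j * (x $ i * x $ j)) \<le> (\<Sum>j\<in>R Q i. \<gamma> i j) * x $ i" for i
      unfolding sum_distrib_right
      using pos bounds by (intro sum_mono mult_left_mono mult_left_le) (auto simp: less_imp_le)
    moreover have "product_family Q x \<in> y_space Q"
      by (simp add: y_space_def product_family_def)
    ultimately show ?thesis
      using x bounds R_sym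
      by (auto simp: FT_feasible_def product_family_apply mult.commute mult_le_one)
  qed
  ultimately show ?thesis
    by auto
qed

theorem theorem7:
  fixes Q :: "real^'n^'n" and c :: "real^'n" and \<gamma> :: "'n \<Rightarrow> 'n \<Rightarrow> real"
  assumes "transpose Q = Q"
    and "\<forall>i. Q $ i $ i = 0"
    and "\<forall>i. \<forall>j\<in>R Q i. \<gamma> i j > 0"
  shows "valid_formulation Q c (FT_feasible Q \<gamma>)"
  using FT_feasible_eq[OF assms(1,3)] milp_objective_product_family
  by (rule valid_formulation_graph)

end
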